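(* Let $n\ge 1$ be an integer. For $\beta>-1$ let $x_1(\beta)<\cdots<x_{2n}(\beta)$ be the zeros of the diagonal Laguerre-Hermite polynomial $H_{n,n}^{(\beta)}(x)$, so that $x_1(\beta),\ldots,x_n(\beta)$ are negative and $x_{n+1}(\beta),\ldots,x_{2n}(\beta)$ are positive. Then each negative zero $x_j(\beta)$, $j=1,\ldots,n$, is a decreasing function of $\beta\in(-1,\infty)$, and each positive zero $x_j(\beta)$, $j=n+1,\ldots,2n$, is an increasing function of $\beta\in(-1,\infty)$.
   Context: For $\beta>-1$, the (diagonal, type II) Laguerre-Hermite multiple orthogonal polynomial $H_{n,n}^{(\beta)}(x)$ is the unique monic polynomial of degree $2n$ satisfying $$\int_{-\infty}^0 x^k H_{n,n}^{(\beta)}(x)|x|^\beta e^{-x^2}\,dx=0,\qquad \int_0^{+\infty} x^k H_{n,n}^{(\beta)}(x)x^\beta e^{-x^2}\,dx=0$$ for $k=0,\ldots,n-1$. It is known that it has $n$ simple zeros in $(-\infty,0)$ and $n$ simple zeros in $(0,+\infty)$. "Increasing" and "decreasing" are meant in the strict sense. *)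

theory Defs
  imports "HOL-Analysis.Analysis" "HOL-Computational_Algebra.Polynomial"
begin

text \<open>
  For \<open>\<beta> > -1\<close> all integrands below are absolutely integrable, so the convention that the
  integral of a non-integrable function is \<open>0\<close> plays no role.
\<close>

definition is_laguerre_hermite :: "nat \<Rightarrow> real \<Rightarrow> real poly \<Rightarrow> bool" where
  "is_laguerre_hermite n \<beta> p \<longleftrightarrow>
     lead_coeff p = 1 \<and> degree p = 2 * n \<and>
     (\<forall>k<n. (LBINT x:{..<0}. x ^ k * poly p x * \<bar>x\<bar> powr \<beta> * exp (- (x\<^sup>2))) = 0) \<and>
     (\<forall>k<n. (LBINT x:{0<..}. x ^ k * poly p x * x powr \<beta> * exp (- (x\<^sup>2))) = 0)"

definition laguerre_hermite :: "nat \<Rightarrow> real \<Rightarrow> real poly" where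
  "laguerre_hermite n \<beta> = (THE p. is_laguerre_hermite n \<beta> p)"

text \<open>The \<open>j\<close>-th smallest real zero, counted from \<open>j = 1\<close>.\<close>

definition laguerre_hermite_zero :: "nat \<Rightarrow> nat \<Rightarrow> real \<Rightarrow> real" where
  "laguerre_hermite_zero n j \<beta> =
     sorted_list_of_set {x. poly (laguerre_hermite n \<beta>) x = 0} ! (j - 1)"

end

theory Submission
  imports Defs
begin

text \<open>
  Reflection \<open>x \<mapsto> -x\<close> exchanges the two families of orthogonality conditions, so the polynomial
  of degree \<open>2 n\<close> is even: \<open>H x = P (x\<^sup>2)\<close> with \<open>P\<close> monic of degree \<open>n\<close>, and only the
  positive half line matters.  There \<open>P\<close> can be written down.  Up to the substitution \<open>t = x\<^sup>2\<close>, the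
  \<open>r\<close>-th moment of \<open>P (x\<^sup>2)\<close> is the Mellin transform of \<open>P t * exp (- t)\<close> at
  \<open>s = (r + 1) / 2\<close>, and integration by parts turns multiplication of a Mellin transform by
  \<open>s - a\<close> into the first-order operator
  \<open>q \<mapsto> t q - t q' - a q\<close>, which is \<open>q \<mapsto> - exp t * t powr (1 - a) * (t powr a * exp (- t) * q)'\<close>
  (\<open>laguerre_raise\<close>).  Orthogonality requires the transform to vanish at
  \<open>s = (\<beta> + 1 + k) / 2\<close> for \<open>k < n\<close>; so \<open>P\<close> arises from the constant \<open>1\<close> by applying
  this operator for the \<open>n\<close> values \<open>a = (\<beta> + 1 + k) / 2\<close>.  This is a Rodrigues formula,
  and it gives existence.  Uniqueness holds because a Mellin
  transform of a polynomial times \<open>exp (- t)\<close> is \<open>Gamma s\<close> times a polynomial in \<open>s\<close> of no larger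
  degree (\<open>half_line_moment_square_interpolation\<close>), and this polynomial cannot have too many zeros.

  The zeros are then followed through a single application of the operator.  For \<open>a > 0\<close> and
  \<open>q\<close> with simple positive zeros \<open>z\<^sub>i\<close> only, Rolle's theorem for \<open>t powr a * exp (- t) * q\<close> gives
  one new zero to the left of all \<open>z\<^sub>i\<close> and one in each gap; a sign change gives one to the right
  (\<open>laguerre_raise_interlacing_roots\<close>).  The new zeros solve
  \<open>a = t - (\<Sum>i. t / (t - z\<^sub>i))\<close>.
  On each interval between consecutive old zeros the right-hand side increases with \<open>t\<close> and decreases as
  the \<open>z\<^sub>i\<close> increase, so the new zeros increase strictly when \<open>a\<close> increases and the \<open>z\<^sub>i\<close> do not
  decrease (\<open>laguerre_raise_roots_increase\<close>).  Raising \<open>\<beta>\<close> raises all the parameters \<open>a\<close>,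
  hence by induction all zeros of \<open>P\<close>; those of \<open>H\<close> are plus and minus their square roots.
\<close>

section \<open>Gaussian moments on the half line\<close>

lemma gaussian_moment:
  fixes r :: real
  assumes "r > -1"
  shows "set_integrable lborel {0<..} (\<lambda>x. x powr r * exp (- x\<^sup>2))"
    and "(LBINT x:{0<..}. x powr r * exp (- x\<^sup>2)) = Gamma ((r + 1) / 2) / 2"
proof -
  \<comment> \<open>Euler's integral for \<open>Gamma s\<close> under the substitution \<open>t = x\<^sup>2\<close>\<close>
  define s where "s = (r + 1) / 2"
  have s: "s > 0" using assms by (simp add: s_def)
  define f where "f = (\<lambda>t::real. t powr (s - 1) / exp t)"
  have int: "(f has_integral Gamma s) {0<..}"
  proof -
    have "((\<lambda>t. if t \<in> {0<..} then f t else 0) has_integral Gamma s) {0..}"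
      using Gamma_integral_real[OF s]
      by (rule has_integral_spike[of "{0}", rotated 2]) (auto simp: f_def)
    thus ?thesis
      by (subst (asm) has_integral_restrict) auto
  qed
  have abs: "f absolutely_integrable_on {0<..}"
    by (rule nonnegative_absolutely_integrable_1)
       (use int in \<open>auto simp: f_def has_integral_integrable_integral\<close>)
  have img: "(\<lambda>x::real. x\<^sup>2) ` {0<..} = {0<..}"
  proof (intro equalityI subsetI)
    fix t :: real assume "t \<in> {0<..}"
    thus "t \<in> (\<lambda>x. x\<^sup>2) ` {0<..}" by (intro image_eqI[of _ _ "sqrt t"]) auto
  qed auto
  have ab: "(\<lambda>x. \<bar>2 * x\<bar> * f (x\<^sup>2)) absolutely_integrable_on {0<..} \<and>
        integral {0<..} (\<lambda>x. \<bar>2 * x\<bar> * f (x\<^sup>2)) = Gamma s"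
  proof (subst has_absolute_integral_change_of_variables_1'[where g = "\<lambda>x. x\<^sup>2"])
    show "((\<lambda>x::real. x\<^sup>2) has_field_derivative 2 * x) (at x within {0<..})" for x
      by (auto intro!: derivative_eq_intros)
    show "inj_on (\<lambda>x::real. x\<^sup>2) {0<..}"
      by (auto simp: inj_on_def)
    show "f absolutely_integrable_on (\<lambda>x. x\<^sup>2) ` {0<..} \<and>
            integral ((\<lambda>x. x\<^sup>2) ` {0<..}) f = Gamma s"
      unfolding img using abs int by auto
  qed simp
  have eq: "\<bar>2 * x\<bar> * f (x\<^sup>2) = 2 * (x powr r * exp (- x\<^sup>2))" if "x \<in> {0<..}" for x
  proof -
    have "x * (x\<^sup>2) powr (s - 1) = x powr 1 * x powr (2 * (s - 1))"
      using that by (simp add: powr_powr flip: powr_numeral)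
    also have "\<dots> = x powr r"
      by (subst powr_add [symmetric]) (simp add: s_def field_simps)
    finally show ?thesis
      using that by (simp add: f_def exp_minus field_simps)
  qed
  have ab': "(\<lambda>x. 2 * (x powr r * exp (- x\<^sup>2))) absolutely_integrable_on {0<..}"
    using ab set_integrable_cong[OF refl refl eq, of "{0<..}" "\<lambda>x. x" lebesgue] by blast
  hence *: "set_integrable lborel {0<..} (\<lambda>x. 2 * (x powr r * exp (- x\<^sup>2)))"
    unfolding set_integrable_def by (subst (asm) integrable_completion) auto
  thus **: "set_integrable lborel {0<..} (\<lambda>x. x powr r * exp (- x\<^sup>2))"
    by simp
  have "Gamma s = integral {0<..} (\<lambda>x. 2 * (x powr r * exp (- x\<^sup>2)))"
    using ab Henstock_Kurzweil_Integration.integral_cong[OF eq, of "{0<..}" "\<lambda>x. x"] by simp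
  thus "(LBINT x:{0<..}. x powr r * exp (- x\<^sup>2)) = Gamma ((r + 1) / 2) / 2"
    using set_borel_integral_eq_integral(2)[OF **] by (simp add: s_def)
qed

definition half_line_moment :: "real \<Rightarrow> real poly \<Rightarrow> real" where
  "half_line_moment r p = (LBINT x:{0<..}. poly p x * (x powr r * exp (- x\<^sup>2)))"

lemma half_line_integrable:
  fixes p :: "real poly"
  assumes "r > -1"
  shows "set_integrable lborel {0<..} (\<lambda>x. poly p x * (x powr r * exp (- x\<^sup>2)))"
  using assms
proof (induction p arbitrary: r)
  case (pCons c p)
  have "set_integrable lborel {0<..} (\<lambda>x. c * (x powr r * exp (- x\<^sup>2)) +
          poly p x * (x powr (r + 1) * exp (- x\<^sup>2)))"
    using pCons by (intro set_integral_add set_integrable_mult_right gaussian_moment) auto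
  also have "?this \<longleftrightarrow> ?case"
    by (intro set_integrable_cong refl) (auto simp: powr_add algebra_simps)
  finally show ?case .
qed (simp add: set_integrable_def)

lemma half_line_moment_0 [simp]: "half_line_moment r 0 = 0"
  by (simp add: half_line_moment_def set_lebesgue_integral_def)

lemma half_line_moment_add:
  "r > -1 \<Longrightarrow> half_line_moment r (p + q) = half_line_moment r p + half_line_moment r q"
  unfolding half_line_moment_def
  by (simp add: distrib_right set_integral_add half_line_integrable)

lemma half_line_moment_diff:
  "r > -1 \<Longrightarrow> half_line_moment r (p - q) = half_line_moment r p - half_line_moment r q"
  unfolding half_line_moment_def
  by (simp add: left_diff_distrib set_integral_diff half_line_integrable)

lemma half_line_moment_monom_mult:
  assumes "r > -1"
  shows "half_line_moment r (monom 1 k * p) = half_line_moment (r + k) p"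
  unfolding half_line_moment_def
  by (rule set_lebesgue_integral_cong)
     (auto simp: poly_monom powr_add powr_realpow mult_ac)

lemma half_line_moment_shift:
  "r > -1 \<Longrightarrow> half_line_moment r (pCons 0 p) = half_line_moment (r + 1) p"
  using half_line_moment_monom_mult[of r 1 p] by (simp add: monom_altdef)

lemma half_line_moment_const:
  "r > -1 \<Longrightarrow> half_line_moment r [:c:] = c * Gamma ((r + 1) / 2) / 2"
  by (simp add: half_line_moment_def gaussian_moment)

abbreviation in_square :: "real poly \<Rightarrow> real poly" where
  "in_square q \<equiv> pcompose q [:0, 0, 1:]"

lemma half_line_moment_square_pCons:
  assumes "r > -1"
  shows "half_line_moment r (in_square (pCons c q)) =
           c * Gamma ((r + 1) / 2) / 2 + half_line_moment (r + 2) (in_square q)"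
proof -
  have "in_square (pCons c q) = [:c:] + pCons 0 (pCons 0 (in_square q))"
    by (simp add: pcompose_pCons)
  thus ?thesis
    using assms by (simp only: half_line_moment_add half_line_moment_shift half_line_moment_const)
      (simp add: half_line_moment_shift algebra_simps)
qed

lemma Gamma_half_shift:
  "r > -1 \<Longrightarrow> Gamma ((r + 2 + 1) / 2) = (r + 1) / 2 * Gamma ((r + 1) / (2::real))"
  using Gamma_plus1[of "(r + 1) / 2"] nonpos_Ints_nonpos[of "(r + 1) / 2"]
  by (auto simp: field_simps)

section \<open>The raising operator\<close>

text \<open>
  This is \<open>- exp t * t powr (1 - a)\<close> times the derivative of \<open>t powr a * exp (- t) * q t\<close>.  The sign is
  chosen so that monic polynomials go to monic polynomials.
\<close>

definition laguerre_raise :: "real \<Rightarrow> real poly \<Rightarrow> real poly" where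
  "laguerre_raise a q = pCons 0 (q - pderiv q) - smult a q"

lemma laguerre_raise_pCons:
  "laguerre_raise a (pCons c q) = pCons (- (a * c)) ([:c:] + laguerre_raise (a + 1) q)"
  by (simp add: laguerre_raise_def pderiv_pCons algebra_simps smult_add_left)

text \<open>
  Integration by parts against \<open>t powr (s - 1)\<close>, where \<open>t = x\<^sup>2\<close> and \<open>s = (r + 1) / 2\<close>.  On polynomials
  it is a consequence of the functional equation of \<open>Gamma\<close> alone, so the proof goes along
  the coefficients and meets no boundary terms.
\<close>

lemma half_line_moment_laguerre_raise:
  assumes "r > -1"
  shows "half_line_moment r (in_square (laguerre_raise a q)) =
           ((r + 1) / 2 - a) * half_line_moment r (in_square q)"
  using assms
proof (induction q arbitrary: r a)
  case 0
  show ?case by (simp add: laguerre_raise_def)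
next
  case (pCons c q)
  have "half_line_moment r (in_square (laguerre_raise a (pCons c q))) =
          - (a * c) * Gamma ((r + 1) / 2) / 2 +
          (c * Gamma ((r + 2 + 1) / 2) / 2 +
           ((r + 2 + 1) / 2 - (a + 1)) * half_line_moment (r + 2) (in_square q))"
    using pCons.prems pCons.IH[of "r + 2" "a + 1"]
    by (simp add: laguerre_raise_pCons half_line_moment_square_pCons pcompose_add
          half_line_moment_add half_line_moment_const)
  thus ?case
    unfolding half_line_moment_square_pCons[OF pCons.prems] Gamma_half_shift[OF pCons.prems]
    by (simp add: field_simps)
qed

section \<open>Moments determine the polynomial\<close>

text \<open>
  The moment of \<open>t ^ i\<close> is half of \<open>Gamma (s + i) = Gamma s * pochhammer s i\<close>, so \<open>Q\<close> arises from \<open>q\<close> by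
  replacing each power with the rising factorial of the same degree.  As a function of \<open>s\<close> the moment
  therefore has at most \<open>degree q\<close> zeros unless \<open>q = 0\<close>.
\<close>

lemma half_line_moment_square_interpolation:
  "\<exists>Q. degree Q \<le> degree q \<and> (q \<noteq> 0 \<longrightarrow> Q \<noteq> 0) \<and>
     (\<forall>r>-1. half_line_moment r (in_square q) = Gamma ((r + 1) / 2) / 2 * poly Q ((r + 1) / 2))"
proof (induction q)
  case (pCons c q)
  then obtain Q where Q: "degree Q \<le> degree q" "q \<noteq> 0 \<longrightarrow> Q \<noteq> 0"
    "\<And>r. r > -1 \<Longrightarrow> half_line_moment r (in_square q) = Gamma ((r + 1) / 2) / 2 * poly Q ((r + 1) / 2)"
    by blast
  \<comment> \<open>Horner's scheme for rising factorials: the shift \<open>r + 2\<close> of the exponent is \<open>s + 1\<close>\<close>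
  define Q' where "Q' = (if q = 0 then [:c:] else pCons c (pcompose Q [:1, 1:]))"
  have "degree Q' \<le> degree (pCons c q)"
    using Q(1) by (simp add: Q'_def degree_pCons_eq_if degree_pcompose)
  moreover have "Q' \<noteq> 0"
    using pCons.hyps Q(2) by (auto simp: Q'_def pcompose_eq_0_iff)
  moreover have "half_line_moment r (in_square (pCons c q)) =
      Gamma ((r + 1) / 2) / 2 * poly Q' ((r + 1) / 2)" if r: "r > -1" for r
  proof -
    have "half_line_moment (r + 2) (in_square q) =
        Gamma ((r + 2 + 1) / 2) / 2 * poly Q ((r + 2 + 1) / 2)"
      using r by (intro Q(3)) simp
    also have "(r + 2 + 1) / 2 = 1 + (r + 1) / 2" by (simp add: field_simps)
    also have "Gamma (1 + (r + 1) / 2) = (r + 1) / 2 * Gamma ((r + 1) / 2)"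
      using Gamma_half_shift[OF r] by (simp add: field_simps)
    finally have "half_line_moment (r + 2) (in_square q) =
        (r + 1) / 2 * Gamma ((r + 1) / 2) / 2 * poly Q (1 + (r + 1) / 2)" .
    moreover have "poly Q' ((r + 1) / 2) =
        c + (if q = 0 then 0 else (r + 1) / 2 * poly Q (1 + (r + 1) / 2))"
      by (simp add: Q'_def poly_pcompose)
    ultimately show ?thesis
      unfolding half_line_moment_square_pCons[OF r]
      by (cases "q = 0") (simp_all add: algebra_simps)
  qed
  ultimately show ?case by blast
qed (auto intro: exI[of _ 0])

lemma moments_determine_square:
  assumes "b > -1" and "degree q < n \<or> q = 0"
    and "\<And>k. k < n \<Longrightarrow> half_line_moment (b + real k) (in_square q) = 0"
  shows "q = 0"
proof (rule ccontr)
  assume "q \<noteq> 0"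
  obtain Q where Q: "degree Q \<le> degree q" "Q \<noteq> 0"
    "\<And>r. r > -1 \<Longrightarrow> half_line_moment r (in_square q) = Gamma ((r + 1) / 2) / 2 * poly Q ((r + 1) / 2)"
    using half_line_moment_square_interpolation[of q] \<open>q \<noteq> 0\<close> by blast
  let ?A = "(\<lambda>k. (b + real k + 1) / 2) ` {..<n}"
  have "poly Q ((b + real k + 1) / 2) = 0" if "k < n" for k
  proof -
    have "Gamma ((b + real k + 1) / 2) > 0"
      using assms(1) by (intro Gamma_real_pos) simp
    thus ?thesis
      using Q(3)[of "b + real k"] assms(3)[OF that] assms(1)
      by (simp add: less_imp_neq [symmetric])
  qed
  hence "?A \<subseteq> {x. poly Q x = 0}" by auto
  hence "card ?A \<le> degree Q"
    using card_mono[OF poly_roots_finite[OF Q(2)]] card_poly_roots_bound[OF Q(2)] le_trans by blast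
  moreover have "card ?A = n"
    by (subst card_image) (auto simp: inj_on_def)
  ultimately show False
    using Q(1) assms(2) \<open>q \<noteq> 0\<close> by simp
qed

lemma even_odd_decomposition:
  fixes p :: "real poly"
  shows "\<exists>e u. p = in_square e + pCons 0 (in_square u) \<and>
     (e \<noteq> 0 \<longrightarrow> 2 * degree e \<le> degree p) \<and> (u \<noteq> 0 \<longrightarrow> 2 * degree u < degree p)"
proof (induction p)
  case 0
  show ?case by (auto intro!: exI[of _ 0])
next
  case (pCons c p)
  show ?case
  proof (cases "p = 0")
    case True
    thus ?thesis by (intro exI[of _ "[:c:]"] exI[of _ 0]) (simp add: pcompose_pCons)
  next
    case False
    from pCons.IH obtain e u where "p = in_square e + pCons 0 (in_square u)"
      "e \<noteq> 0 \<longrightarrow> 2 * degree e \<le> degree p" "u \<noteq> 0 \<longrightarrow> 2 * degree u < degree p" by blast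
    with False show ?thesis
      by (intro exI[of _ "pCons c u"] exI[of _ e])
         (auto simp: pcompose_pCons degree_pCons_eq_if algebra_simps)
  qed
qed

abbreviation reflect :: "real poly \<Rightarrow> real poly" where
  "reflect p \<equiv> pcompose p [:0, -1:]"

text \<open>
  The conditions on the two half lines say the same about \<open>p\<close> and its reflection, hence about its even
  and odd parts separately.  The odd part \<open>x u(x\<^sup>2)\<close> has the moments of \<open>u(x\<^sup>2)\<close> with
  exponent one higher, and each of \<open>e\<close>, \<open>u\<close> has degree below \<open>n\<close>, the number of its vanishing moments.
\<close>

lemma moments_determine:
  assumes b: "b > -1" and deg: "degree p < 2 * n"
    and pos: "\<And>k. k < n \<Longrightarrow> half_line_moment (b + real k) p = 0"
    and neg: "\<And>k. k < n \<Longrightarrow> half_line_moment (b + real k) (reflect p) = 0"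
  shows "p = 0"
proof -
  obtain e u where p: "p = in_square e + pCons 0 (in_square u)"
    and d: "e \<noteq> 0 \<longrightarrow> 2 * degree e \<le> degree p" "u \<noteq> 0 \<longrightarrow> 2 * degree u < degree p"
    using even_odd_decomposition by blast
  have refl: "reflect p = in_square e - pCons 0 (in_square u)"
    by (simp add: p pcompose_add pcompose_pCons flip: pcompose_assoc)
  have m: "half_line_moment (b + real k) (in_square e) = 0 \<and>
      half_line_moment (b + 1 + real k) (in_square u) = 0" if "k < n" for k
    using pos[OF that] neg[OF that] b unfolding refl
    by (subst (asm) p)
       (simp add: half_line_moment_add half_line_moment_diff half_line_moment_shift add_ac)
  have "e = 0"
    by (rule moments_determine_square[of b _ n]) (use b d(1) deg m in auto)
  moreover have "u = 0"
    by (rule moments_determine_square[of "b + 1" _ n]) (use b d(2) deg m in auto)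
  ultimately show ?thesis using p by simp
qed

lemma is_laguerre_hermite_iff_moments:
  assumes "\<beta> > -1"
  shows "is_laguerre_hermite n \<beta> p \<longleftrightarrow> lead_coeff p = 1 \<and> degree p = 2 * n \<and>
    (\<forall>k<n. half_line_moment (\<beta> + real k) (reflect p) = 0) \<and>
    (\<forall>k<n. half_line_moment (\<beta> + real k) p = 0)"
proof -
  have pos: "(LBINT x:{0<..}. x ^ k * poly p x * x powr \<beta> * exp (- (x\<^sup>2))) =
      half_line_moment (\<beta> + real k) p" for k p
    unfolding half_line_moment_def
    by (rule set_lebesgue_integral_cong) (auto simp: powr_add powr_realpow)
  have reflected_ray: "{x::real. - x \<in> {..<0}} = {0<..}" by auto
  have neg: "(LBINT x:{..<0}. x ^ k * poly p x * \<bar>x\<bar> powr \<beta> * exp (- (x\<^sup>2))) =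
      (-1) ^ k * half_line_moment (\<beta> + real k) (reflect p)" for k
  proof -
    have "(LBINT x:{..<0}. x ^ k * poly p x * \<bar>x\<bar> powr \<beta> * exp (- (x\<^sup>2))) =
       (LBINT x:{0<..}. (-1) ^ k * (x ^ k * poly (reflect p) x * x powr \<beta> * exp (- (x\<^sup>2))))"
      unfolding set_integral_reflect[of "{..<0}"] reflected_ray
    proof (intro set_lebesgue_integral_cong allI impI)
      fix x :: real assume "x \<in> {0<..}"
      thus "(- x) ^ k * poly p (- x) * \<bar>- x\<bar> powr \<beta> * exp (- (- x)\<^sup>2) =
          (- 1) ^ k * (x ^ k * poly (reflect p) x * x powr \<beta> * exp (- x\<^sup>2))"
        by (subst power_minus) (simp add: poly_pcompose)
    qed simp
    thus ?thesis by (simp add: pos)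
  qed
  show ?thesis
    by (simp add: is_laguerre_hermite_def pos neg)
qed

lemma is_laguerre_hermite_unique:
  assumes "\<beta> > -1" "is_laguerre_hermite n \<beta> p" "is_laguerre_hermite n \<beta> q"
  shows "p = q"
proof (cases "n = 0")
  case True
  thus ?thesis using assms(2,3)
    by (metis is_laguerre_hermite_def degree_0_id mult_0_right)
next
  case False
  note pq = assms(2,3)[unfolded is_laguerre_hermite_iff_moments[OF assms(1)]]
  have "degree (p - q) < 2 * n"
  proof (rule degree_lessI)
    show "\<forall>k\<ge>2 * n. coeff (p - q) k = 0"
    proof (intro allI impI)
      fix k assume "2 * n \<le> k"
      thus "coeff (p - q) k = 0"
        using pq by (cases "k = 2 * n") (auto simp: coeff_eq_0)
    qed
  qed (use False in simp)
  hence "p - q = 0"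
    by (rule moments_determine[OF assms(1)])
       (use pq assms(1) in \<open>auto simp: half_line_moment_diff pcompose_diff\<close>)
  thus ?thesis by simp
qed

section \<open>Zeros under the raising operator\<close>

definition positive_simple_roots :: "nat \<Rightarrow> (nat \<Rightarrow> real) \<Rightarrow> real poly \<Rightarrow> bool" where
  "positive_simple_roots m z q \<longleftrightarrow>
     strict_mono_on {..<m} z \<and> (\<forall>i<m. 0 < z i) \<and> q = (\<Prod>i<m. [:- z i, 1:])"

lemma degree_prod_linear:
  "degree (\<Prod>i<m. [:- z i, 1 :: real:]) = m" "lead_coeff (\<Prod>i<m. [:- z i, 1 :: real:]) = 1"
  by (subst degree_prod_eq_sum_degree) (auto simp: lead_coeff_prod)

lemma positive_simple_rootsD:
  assumes "positive_simple_roots m z q"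
  shows "degree q = m" "lead_coeff q = 1" "poly q x = 0 \<longleftrightarrow> (\<exists>i<m. x = z i)"
  using assms degree_prod_linear[where m = m and z = z]
  by (auto simp: positive_simple_roots_def poly_prod)

lemma positive_simple_rootsI:
  assumes "strict_mono_on {..<m} z" "\<And>i. i < m \<Longrightarrow> 0 < z i" "\<And>i. i < m \<Longrightarrow> poly q (z i) = 0"
    and "degree q = m" "lead_coeff q = 1"
  shows "positive_simple_roots m z q"
proof -
  have "inj_on z {..<m}"
    using assms(1) by (rule strict_mono_on_imp_inj_on)
  hence "q = (\<Prod>i<m. [:- z i, 1:])"
    using assms degree_prod_linear[where m = m and z = z]
    by (intro poly_eqI_degree_lead_coeff[where n = m and A = "z ` {..<m}"])
       (auto simp: card_image poly_prod)
  thus ?thesis using assms by (simp add: positive_simple_roots_def)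
qed

lemma laguerre_raise_monic:
  assumes "lead_coeff q = 1"
  shows "degree (laguerre_raise a q) = Suc (degree q)" "lead_coeff (laguerre_raise a q) = 1"
proof -
  have top: "coeff (laguerre_raise a q) (Suc (degree q)) = 1"
    using assms by (simp add: laguerre_raise_def coeff_pderiv coeff_eq_0)
  have "degree (laguerre_raise a q) \<le> Suc (degree q)"
    by (rule degree_le) (auto simp: laguerre_raise_def coeff_pCons coeff_pderiv coeff_eq_0 split: nat.split)
  moreover have "Suc (degree q) \<le> degree (laguerre_raise a q)"
    by (rule le_degree) (simp add: top)
  ultimately show "degree (laguerre_raise a q) = Suc (degree q)" by simp
  with top show "lead_coeff (laguerre_raise a q) = 1" by simp
qed

lemma weighted_poly_has_derivative:
  assumes "x > (0::real)"
  shows "((\<lambda>t. t powr a * exp (- t) * poly q t) has_real_derivative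
           - (x powr (a - 1) * exp (- x) * poly (laguerre_raise a q) x)) (at x)"
  using assms
  by (auto intro!: derivative_eq_intros simp: laguerre_raise_def powr_diff field_simps)

text \<open>
  Allowing \<open>x = 0\<close> as left end point produces the zero to the left of all old ones: for \<open>a > 0\<close> the
  factor \<open>t powr a\<close> supplies a further zero of the weighted polynomial at the origin.
\<close>

lemma laguerre_raise_root_between:
  assumes a: "a > 0" and xy: "0 \<le> x" "x < y"
    and zero: "x = 0 \<or> poly q x = 0" "poly q y = 0"
  shows "\<exists>t. x < t \<and> t < y \<and> poly (laguerre_raise a q) t = 0"
proof -
  let ?\<phi> = "\<lambda>t. t powr a * exp (- t) * poly q t"
  have "\<exists>t. x < t \<and> t < y \<and> (*) (- (t powr (a - 1) * exp (- t) * poly (laguerre_raise a q) t)) = (\<lambda>v. 0)"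
  proof (rule Rolle_deriv[OF xy(2)])
    show "?\<phi> x = ?\<phi> y" using zero a by auto
    show "continuous_on {x..y} ?\<phi>"
      using a xy by (intro continuous_intros continuous_on_powr') auto
  next
    fix t assume "x < t" "t < y"
    thus "(?\<phi> has_derivative (*) (- (t powr (a - 1) * exp (- t) * poly (laguerre_raise a q) t))) (at t)"
      using weighted_poly_has_derivative[of t a q] xy
      by (simp add: has_field_derivative_def)
  qed
  then obtain t where t: "x < t" "t < y"
    "(*) (- (t powr (a - 1) * exp (- t) * poly (laguerre_raise a q) t)) = (\<lambda>v. 0)" by blast
  from fun_cong[OF t(3), of 1] have "poly (laguerre_raise a q) t = 0"
    using t(1,2) xy by simp
  thus ?thesis using t by blast
qed

lemma poly_pderiv_prod_linear:
  "poly (pderiv (\<Prod>i\<in>A. [:- z i, 1 :: real:])) x = (\<Sum>i\<in>A. \<Prod>j\<in>A - {i}. (x - z j))"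
  by (simp add: pderiv_prod pderiv_pCons poly_sum poly_prod)

text \<open>
  At the largest zero \<open>x\<close> of \<open>q\<close> (at the origin, if \<open>q = 1\<close>) the raised polynomial is negative, since
  its value there is \<open>- x * q' x\<close> with \<open>q' x > 0\<close> (respectively \<open>- a\<close>); being monic, it is positive
  further to the right.
\<close>

lemma laguerre_raise_root_above:
  assumes a: "a > 0" and z: "positive_simple_roots m z q"
  shows "\<exists>t>0. (\<forall>i<m. z i < t) \<and> poly (laguerre_raise a q) t = 0"
proof -
  let ?p = "laguerre_raise a q"
  define x where "x = (if m = 0 then 0 else z (m - 1))"
  have zm: "z i < z j" if "i < j" "j < m" for i j
    using z that by (auto simp: positive_simple_roots_def strict_mono_on_def)
  have x_nonneg: "0 \<le> x"
    using z by (auto simp: x_def positive_simple_roots_def less_imp_le)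
  have z_le_x: "z i \<le> x" if "i < m" for i
    using zm[of i "m - 1"] that by (cases "i = m - 1") (auto simp: x_def less_eq_real_def)
  have "poly ?p x < 0"
  proof (cases "m = 0")
    case True
    thus ?thesis using a z by (simp add: x_def laguerre_raise_def positive_simple_roots_def)
  next
    case False
    then obtain l where m: "m = Suc l" by (cases m) auto
    have "poly (pderiv q) x = (\<Sum>i<m. \<Prod>j\<in>{..<m} - {i}. (x - z j))"
      using z by (simp add: positive_simple_roots_def poly_pderiv_prod_linear)
    \<comment> \<open>only the summand that omits the vanishing factor \<open>x - z l\<close> survives\<close>
    also have "\<dots> = (\<Sum>i\<in>{l}. \<Prod>j\<in>{..<m} - {i}. (x - z j))"
      by (rule sum.mono_neutral_right) (auto simp: m x_def)
    also have "\<dots> = (\<Prod>j<l. (x - z j))"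
      by (auto simp: m intro!: prod.cong)
    also have "\<dots> > 0"
      using zm[of _ l] by (intro prod_pos) (auto simp: m x_def)
    finally have "poly (pderiv q) x > 0" .
    moreover have "poly q x = 0"
      using positive_simple_rootsD(3)[OF z] by (auto simp: m x_def)
    moreover have "x > 0" using z by (auto simp: m x_def positive_simple_roots_def)
    ultimately show ?thesis by (simp add: laguerre_raise_def)
  qed
  moreover have "lead_coeff ?p = 1"
    using positive_simple_rootsD(2)[OF z] by (rule laguerre_raise_monic)
  then obtain y where "\<forall>t\<ge>y. poly ?p t \<ge> 1"
    using poly_pinfty_gt_lc[of ?p] by auto
  hence "poly ?p (max y (x + 1)) > 0" by (smt (verit) max.cobounded1)
  moreover have "x < max y (x + 1)" by simp
  ultimately obtain t where "x < t" "poly ?p t = 0"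
    using poly_IVT_pos[of x "max y (x + 1)" ?p] by blast
  moreover have "0 < t" "\<forall>i<m. z i < t"
    using \<open>x < t\<close> x_nonneg z_le_x by force+
  ultimately show ?thesis by blast
qed

text \<open>
  Each of the \<open>m + 1\<close> intervals cut out of \<open>(0, \<infinity>)\<close> by the old zeros contains a zero; as the degree is
  \<open>m + 1\<close>, these are all zeros.
\<close>

lemma laguerre_raise_interlacing_roots:
  assumes a: "a > 0" and z: "positive_simple_roots m z q"
  shows "\<exists>y. positive_simple_roots (Suc m) y (laguerre_raise a q) \<and>
     (\<forall>j\<le>m. \<forall>i<m. if i < j then z i < y j else y j < z i)"
proof -
  have z_mono: "z i < z j" if "i < j" "j < m" for i j
    using z that by (auto simp: positive_simple_roots_def strict_mono_on_def)
  have z_le: "z i \<le> z j" if "i \<le> j" "j < m" for i j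
    using z_mono[of i j] that by (cases "i = j") auto
  have z_pos: "0 < z i" if "i < m" for i
    using z that by (auto simp: positive_simple_roots_def)
  have ex: "\<exists>t>0. poly (laguerre_raise a q) t = 0 \<and> (\<forall>i<m. if i < j then z i < t else t < z i)"
    if j: "j \<le> m" for j
  proof (cases "j = m")
    case True
    thus ?thesis using laguerre_raise_root_above[OF a z] by auto
  next
    case False
    define x where "x = (if j = 0 then 0 else z (j - 1))"
    have "\<exists>t. x < t \<and> t < z j \<and> poly (laguerre_raise a q) t = 0"
    proof (rule laguerre_raise_root_between[OF a])
      show "0 \<le> x" "x < z j"
        using j False z_pos[of "j - 1"] z_pos[of j] z_mono[of "j - 1" j]
        by (auto simp: x_def less_imp_le)
      show "poly q (z j) = 0"
        using j False positive_simple_rootsD(3)[OF z] by (metis le_neq_implies_less)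
      show "x = 0 \<or> poly q x = 0"
      proof (cases "j = 0")
        case j0: False
        have "j - 1 < m" using j False by simp
        thus ?thesis using j0 positive_simple_rootsD(3)[OF z, of x] by (auto simp: x_def)
      qed (simp add: x_def)
    qed
    then obtain t where t: "x < t" "t < z j" "poly (laguerre_raise a q) t = 0" by blast
    have "0 \<le> x" using z_pos[of "j - 1"] j False by (auto simp: x_def less_eq_real_def)
    moreover have "z i < t" if "i < j" for i
    proof -
      have "z i \<le> z (j - 1)" using z_le[of i "j - 1"] that j False by simp
      thus ?thesis using that t by (simp add: x_def)
    qed
    moreover have "t < z i" if "\<not> i < j" "i < m" for i
      using z_le[of j i] that t by simp
    ultimately show ?thesis using t by (intro exI[of _ t]) auto
  qed
  then obtain y where y: "\<And>j. j \<le> m \<Longrightarrow> y j > 0"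
    "\<And>j. j \<le> m \<Longrightarrow> poly (laguerre_raise a q) (y j) = 0"
    "\<And>j i. j \<le> m \<Longrightarrow> i < m \<Longrightarrow> if i < j then z i < y j else y j < z i"
    by metis
  have "y i < y j" if "i < j" "j < Suc m" for i j
    using y(3)[of i i] y(3)[of j i] that by auto
  hence "positive_simple_roots (Suc m) y (laguerre_raise a q)"
    using y(1,2) laguerre_raise_monic[OF positive_simple_rootsD(2)[OF z]] positive_simple_rootsD(1)[OF z]
    by (intro positive_simple_rootsI) (auto simp: strict_mono_on_def)
  thus ?thesis using y(3) by blast
qed

text \<open>Divide the equation \<open>t q - t q' - a q = 0\<close> by \<open>q\<close> and use the logarithmic derivative of \<open>q\<close>.\<close>

lemma laguerre_raise_root_equation:
  assumes z: "positive_simple_roots m z q" and root: "poly (laguerre_raise a q) t = 0"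
    and ne: "\<And>i. i < m \<Longrightarrow> t \<noteq> z i"
  shows "a = t - (\<Sum>i<m. t / (t - z i))"
proof -
  have q: "q = (\<Prod>i<m. [:- z i, 1:])" using z by (simp add: positive_simple_roots_def)
  have "(\<Prod>j\<in>{..<m} - {i}. (t - z j)) = poly q t / (t - z i)" if "i < m" for i
    using that ne[OF that] prod.remove[of "{..<m}" i "\<lambda>j. t - z j"] by (simp add: q poly_prod)
  hence "poly (pderiv q) t = poly q t * (\<Sum>i<m. 1 / (t - z i))"
    unfolding q poly_pderiv_prod_linear by (simp add: sum_distrib_left flip: q)
  hence "poly q t * (t - (\<Sum>i<m. t / (t - z i)) - a) = 0"
    using root by (simp add: laguerre_raise_def algebra_simps sum_distrib_left sum_distrib_right)
  moreover have "poly q t \<noteq> 0"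
    using positive_simple_rootsD(3)[OF z] ne by blast
  ultimately show ?thesis by simp
qed

text \<open>
  Suppose the \<open>j\<close>-th new zeros satisfied \<open>y' j \<le> y j\<close>.  By interlacing, for every \<open>i\<close> the points \<open>y j\<close> and \<open>y' j\<close>
  lie on the same side of \<open>z i\<close> and \<open>z' i\<close> respectively, so the summands of the root equations can be compared one by
  one, giving \<open>a' \<le> a\<close>.  Comparing two configurations directly avoids differentiating
  zeros with respect to a parameter.
\<close>

lemma laguerre_raise_roots_increase:
  assumes ab: "0 < a" "a < a'"
    and z: "positive_simple_roots m z q" and z': "positive_simple_roots m z' q'"
    and le: "\<And>i. i < m \<Longrightarrow> z i \<le> z' i"
  shows "\<exists>y y'. positive_simple_roots (Suc m) y (laguerre_raise a q) \<and>
     positive_simple_roots (Suc m) y' (laguerre_raise a' q') \<and> (\<forall>j<Suc m. y j < y' j)"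
proof -
  have "0 < a'" using ab by simp
  obtain y where y: "positive_simple_roots (Suc m) y (laguerre_raise a q)"
    and il: "\<And>i j. j \<le> m \<Longrightarrow> i < m \<Longrightarrow> if i < j then z i < y j else y j < z i"
    using laguerre_raise_interlacing_roots[OF ab(1) z] by blast
  obtain y' where y': "positive_simple_roots (Suc m) y' (laguerre_raise a' q')"
    and il': "\<And>i j. j \<le> m \<Longrightarrow> i < m \<Longrightarrow> if i < j then z' i < y' j else y' j < z' i"
    using laguerre_raise_interlacing_roots[OF \<open>0 < a'\<close> z'] by blast
  have "y j < y' j" if "j < Suc m" for j
  proof (rule ccontr)
    assume "\<not> y j < y' j"
    hence t: "y' j \<le> y j" "0 < y' j"
      using y' that by (auto simp: positive_simple_roots_def)
    have "y j / (y j - z i) \<le> y' j / (y' j - z' i)" if i: "i < m" for i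
    proof -
      have zz: "0 < z i" "z i \<le> z' i" using i z le by (auto simp: positive_simple_roots_def)
      show ?thesis
      proof (cases "i < j")
        case True
        hence d: "0 < y' j - z' i" "y' j - z' i \<le> y j - z i"
          using il'[of j i] i \<open>j < Suc m\<close> t zz by auto
        \<comment> \<open>after splitting off \<open>1\<close>, numerator and denominator move in favourable directions\<close>
        have "y j / (y j - z i) = 1 + z i / (y j - z i)"
          using d by (simp add: field_simps)
        also have "\<dots> \<le> 1 + z' i / (y' j - z' i)"
          using zz d by (intro add_left_mono frac_le) auto
        also have "\<dots> = y' j / (y' j - z' i)"
          using d by (simp add: field_simps)
        finally show ?thesis .
      next
        case False
        hence d: "0 < z i - y j" "z i - y j \<le> z' i - y' j"
          using il[of j i] i \<open>j < Suc m\<close> t zz by auto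
        have "y' j / (z' i - y' j) \<le> y j / (z i - y j)"
          using t d by (intro frac_le) auto
        thus ?thesis
          by (metis minus_diff_eq minus_divide_right neg_le_iff_le)
      qed
    qed
    hence "(\<Sum>i<m. y j / (y j - z i)) \<le> (\<Sum>i<m. y' j / (y' j - z' i))"
      by (intro sum_mono) auto
    moreover have "a = y j - (\<Sum>i<m. y j / (y j - z i))"
    proof (rule laguerre_raise_root_equation[OF z])
      show "poly (laguerre_raise a q) (y j) = 0"
        using positive_simple_rootsD(3)[OF y] that by blast
      show "y j \<noteq> z i" if "i < m" for i
        using il[of j i] that \<open>j < Suc m\<close> by (auto split: if_splits)
    qed
    moreover have "a' = y' j - (\<Sum>i<m. y' j / (y' j - z' i))"
    proof (rule laguerre_raise_root_equation[OF z'])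
      show "poly (laguerre_raise a' q') (y' j) = 0"
        using positive_simple_rootsD(3)[OF y'] that by blast
      show "y' j \<noteq> z' i" if "i < m" for i
        using il'[of j i] that \<open>j < Suc m\<close> by (auto split: if_splits)
    qed
    ultimately show False using ab t by linarith
  qed
  with y y' show ?thesis by blast
qed

section \<open>The Laguerre-Hermite polynomial and its zeros\<close>

text \<open>
  Up to normalisation these are the Konhauser biorthogonal polynomials, orthogonal on
  the half line to the powers \<open>t powr (k / 2)\<close>, \<open>k < n\<close>, with weight \<open>t powr (b - 1) * exp (- t)\<close>.
\<close>

primrec laguerre_tower :: "real \<Rightarrow> nat \<Rightarrow> real poly" where
  "laguerre_tower b 0 = 1"
| "laguerre_tower b (Suc k) = laguerre_raise (b + real k / 2) (laguerre_tower b k)"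

lemma laguerre_tower_monic:
  "degree (laguerre_tower b n) = n \<and> lead_coeff (laguerre_tower b n) = 1"
proof (induction n)
  case (Suc n)
  note monic = laguerre_raise_monic[OF conjunct2[OF Suc.IH], of "b + real n / 2"]
  show ?case unfolding laguerre_tower.simps monic(2) using monic(1) Suc.IH by simp
qed simp

lemma laguerre_tower_roots_increase:
  assumes "0 < b" "b < b'"
  shows "\<exists>z z'. positive_simple_roots n z (laguerre_tower b n) \<and>
     positive_simple_roots n z' (laguerre_tower b' n) \<and> (\<forall>i<n. z i < z' i)"
proof (induction n)
  case 0
  show ?case by (simp add: positive_simple_roots_def strict_mono_on_def)
next
  case (Suc n)
  then obtain z z' where "positive_simple_roots n z (laguerre_tower b n)"
    "positive_simple_roots n z' (laguerre_tower b' n)" "\<forall>i<n. z i < z' i" by blast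
  thus ?case
    using laguerre_raise_roots_increase[of "b + real n / 2" "b' + real n / 2" n z _ z'] assms
    by (simp add: less_imp_le)
qed

lemma laguerre_tower_moment:
  assumes "r > -1"
  shows "half_line_moment r (in_square (laguerre_tower b n)) =
     (\<Prod>k<n. (r + 1) / 2 - (b + real k / 2)) * (Gamma ((r + 1) / 2) / 2)"
  by (induction n)
     (use assms half_line_moment_const[of r 1]
      in \<open>simp_all add: half_line_moment_laguerre_raise one_pCons pcompose_const\<close>)

lemma laguerre_hermite_eq:
  assumes "\<beta> > -1"
  shows "laguerre_hermite n \<beta> = in_square (laguerre_tower ((\<beta> + 1) / 2) n)"
proof -
  let ?p = "in_square (laguerre_tower ((\<beta> + 1) / 2) n)"
  have "half_line_moment (\<beta> + real k) ?p = 0" if "k < n" for k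
  proof -
    have "(\<Prod>i<n. (\<beta> + real k + 1) / 2 - ((\<beta> + 1) / 2 + real i / 2)) = 0"
      using that by (intro prod_zero) (auto intro!: bexI[of _ k] simp: field_simps)
    thus ?thesis using assms by (subst laguerre_tower_moment) simp_all
  qed
  moreover have "reflect ?p = ?p"
    by (simp add: pcompose_pCons flip: pcompose_assoc)
  moreover have "degree ?p = 2 * n"
    using laguerre_tower_monic by (simp add: degree_pcompose)
  moreover have "lead_coeff ?p = 1"
    using conjunct2[OF laguerre_tower_monic] by (subst lead_coeff_comp) (simp_all del: One_nat_def)
  ultimately have "is_laguerre_hermite n \<beta> ?p"
    using assms by (simp add: is_laguerre_hermite_iff_moments)
  thus ?thesis
    unfolding laguerre_hermite_def
    using is_laguerre_hermite_unique[OF assms] by (intro the_equality) auto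
qed

lemma nth_sorted_list_of_set_image:
  fixes h :: "nat \<Rightarrow> real"
  assumes "strict_mono_on {1..N} h" "j \<in> {1..N}"
  shows "sorted_list_of_set (h ` {1..N}) ! (j - 1) = h j"
proof -
  let ?l = "map h [1..<Suc N]"
  have "sorted_wrt (<) ?l"
    using assms(1) by (auto simp: sorted_wrt_iff_nth_less strict_mono_on_def simp del: upt_Suc)
  hence "sorted_list_of_set (set ?l) = ?l"
    by (intro strict_sorted_equal) auto
  moreover have "set ?l = h ` {1..N}" by auto
  moreover have "?l ! (j - 1) = h j"
    using assms(2) by (subst nth_map) (auto simp del: upt_Suc simp: nth_upt)
  ultimately show ?thesis by (simp del: upt_Suc)
qed

text \<open>
  With \<open>z 0 < \<dots> < z (n - 1)\<close>, the numbers \<open>\<plusminus>sqrt (z i)\<close> in increasing order, counted from \<open>j = 1\<close>.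
\<close>

definition symmetric_square_roots :: "nat \<Rightarrow> (nat \<Rightarrow> real) \<Rightarrow> nat \<Rightarrow> real" where
  "symmetric_square_roots n z j = (if j \<le> n then - sqrt (z (n - j)) else sqrt (z (j - n - 1)))"

lemma symmetric_square_roots_enumerate:
  assumes "positive_simple_roots n z q"
  shows "strict_mono_on {1..2 * n} (symmetric_square_roots n z)"
    and "{x. poly (in_square q) x = 0} = symmetric_square_roots n z ` {1..2 * n}"
proof -
  have pos: "0 < z i" if "i < n" for i using assms that by (auto simp: positive_simple_roots_def)
  have mono: "z i < z j" if "i < j" "j < n" for i j
    using assms that by (auto simp: positive_simple_roots_def strict_mono_on_def)
  show "strict_mono_on {1..2 * n} (symmetric_square_roots n z)"
  proof (rule strict_mono_onI)
    fix i j assume ij: "i \<in> {1..2 * n}" "j \<in> {1..2 * n}" "i < j"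
    consider "j \<le> n" | "i \<le> n" "n < j" | "n < i" by linarith
    thus "symmetric_square_roots n z i < symmetric_square_roots n z j"
    proof cases
      case 1
      thus ?thesis using ij mono[of "n - j" "n - i"] by (simp add: symmetric_square_roots_def)
    next
      case 2
      hence "- sqrt (z (n - i)) < 0" "0 < sqrt (z (j - n - 1))"
        using ij pos[of "n - i"] pos[of "j - n - 1"] by auto
      hence "- sqrt (z (n - i)) < sqrt (z (j - n - 1))" by linarith
      thus ?thesis using 2 by (simp add: symmetric_square_roots_def)
    next
      case 3
      thus ?thesis using ij mono[of "i - n - 1" "j - n - 1"] by (simp add: symmetric_square_roots_def)
    qed
  qed
  show "{x. poly (in_square q) x = 0} = symmetric_square_roots n z ` {1..2 * n}"
  proof (intro equalityI subsetI)
    fix x assume "x \<in> {x. poly (in_square q) x = 0}"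
    hence "poly q (x\<^sup>2) = 0" by (simp add: poly_pcompose power2_eq_square)
    then obtain i where i: "i < n" "x\<^sup>2 = z i" using positive_simple_rootsD(3)[OF assms] by blast
    hence abs: "sqrt (z i) = \<bar>x\<bar>" by (metis real_sqrt_abs)
    show "x \<in> symmetric_square_roots n z ` {1..2 * n}"
    proof (cases "x < 0")
      case True
      thus ?thesis using i abs
        by (intro image_eqI[of _ _ "n - i"]) (auto simp: symmetric_square_roots_def)
    next
      case False
      thus ?thesis using i abs
        by (intro image_eqI[of _ _ "n + 1 + i"]) (auto simp: symmetric_square_roots_def)
    qed
  next
    fix x assume "x \<in> symmetric_square_roots n z ` {1..2 * n}"
    then obtain j where j: "j \<in> {1..2 * n}" "x = symmetric_square_roots n z j" by blast
    define i where "i = (if j \<le> n then n - j else j - n - 1)"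
    have "i < n" using j by (auto simp: i_def)
    moreover have "x\<^sup>2 = z i"
      using j pos[OF \<open>i < n\<close>] by (auto simp: i_def symmetric_square_roots_def)
    ultimately have "poly q (x\<^sup>2) = 0" using positive_simple_rootsD(3)[OF assms] by blast
    thus "x \<in> {x. poly (in_square q) x = 0}" by (simp add: poly_pcompose power2_eq_square)
  qed
qed

lemma laguerre_hermite_zero_eq:
  assumes "\<beta> > -1" "positive_simple_roots n z (laguerre_tower ((\<beta> + 1) / 2) n)" "j \<in> {1..2 * n}"
  shows "laguerre_hermite_zero n j \<beta> = symmetric_square_roots n z j"
  using nth_sorted_list_of_set_image[OF symmetric_square_roots_enumerate(1)[OF assms(2)] assms(3)]
  by (simp add: laguerre_hermite_zero_def laguerre_hermite_eq[OF assms(1)]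
        symmetric_square_roots_enumerate(2)[OF assms(2)])

theorem corollary3p3:
  fixes n :: nat
  assumes "n \<ge> 1"
  shows "(\<forall>\<beta>>-1.
            strict_mono_on {1..2 * n} (\<lambda>j. laguerre_hermite_zero n j \<beta>) \<and>
            {x. poly (laguerre_hermite n \<beta>) x = 0} =
              (\<lambda>j. laguerre_hermite_zero n j \<beta>) ` {1..2 * n} \<and>
            (\<forall>j\<in>{1..n}. laguerre_hermite_zero n j \<beta> < 0) \<and>
            (\<forall>j\<in>{n + 1..2 * n}. laguerre_hermite_zero n j \<beta> > 0)) \<and>
         (\<forall>j\<in>{1..n}. strict_antimono_on {-1<..} (laguerre_hermite_zero n j)) \<and>
         (\<forall>j\<in>{n + 1..2 * n}. strict_mono_on {-1<..} (laguerre_hermite_zero n j))"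
proof -
  have zeros: "strict_mono_on {1..2 * n} (\<lambda>j. laguerre_hermite_zero n j \<beta>) \<and>
      {x. poly (laguerre_hermite n \<beta>) x = 0} = (\<lambda>j. laguerre_hermite_zero n j \<beta>) ` {1..2 * n} \<and>
      (\<forall>j\<in>{1..n}. laguerre_hermite_zero n j \<beta> < 0) \<and>
      (\<forall>j\<in>{n + 1..2 * n}. laguerre_hermite_zero n j \<beta> > 0)"
    if \<beta>: "\<beta> > -1" for \<beta>
  proof -
    have "0 < (\<beta> + 1) / 2" using \<beta> by simp
    then obtain z where z: "positive_simple_roots n z (laguerre_tower ((\<beta> + 1) / 2) n)"
      using laguerre_tower_roots_increase[of "(\<beta> + 1) / 2" "(\<beta> + 1) / 2 + 1" n] by auto
    have pos: "0 < z i" if "i < n" for i using z that by (auto simp: positive_simple_roots_def)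
    note eq = laguerre_hermite_zero_eq[OF \<beta> z]
    have "strict_mono_on {1..2 * n} (\<lambda>j. laguerre_hermite_zero n j \<beta>)"
      using symmetric_square_roots_enumerate(1)[OF z] by (simp add: strict_mono_on_def eq)
    moreover have "{x. poly (laguerre_hermite n \<beta>) x = 0} =
        (\<lambda>j. laguerre_hermite_zero n j \<beta>) ` {1..2 * n}"
      unfolding laguerre_hermite_eq[OF \<beta>] symmetric_square_roots_enumerate(2)[OF z]
      by (rule image_cong) (simp_all add: eq)
    moreover have "laguerre_hermite_zero n j \<beta> < 0" if "j \<in> {1..n}" for j
      using that pos[of "n - j"] eq[of j] by (auto simp: symmetric_square_roots_def)
    moreover have "laguerre_hermite_zero n j \<beta> > 0" if "j \<in> {n + 1..2 * n}" for j
      using that pos[of "j - n - 1"] eq[of j] by (auto simp: symmetric_square_roots_def)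
    ultimately show ?thesis by blast
  qed
  have "(j \<le> n \<longrightarrow> laguerre_hermite_zero n j \<gamma> < laguerre_hermite_zero n j \<beta>) \<and>
        (n < j \<longrightarrow> laguerre_hermite_zero n j \<beta> < laguerre_hermite_zero n j \<gamma>)"
    if \<beta>\<gamma>: "-1 < \<beta>" "\<beta> < \<gamma>" and j: "j \<in> {1..2 * n}" for \<beta> \<gamma> j
  proof -
    have "0 < (\<beta> + 1) / 2" "(\<beta> + 1) / 2 < (\<gamma> + 1) / 2" using \<beta>\<gamma> by simp_all
    then obtain z z' where z: "positive_simple_roots n z (laguerre_tower ((\<beta> + 1) / 2) n)"
      and z': "positive_simple_roots n z' (laguerre_tower ((\<gamma> + 1) / 2) n)"
      and less: "\<And>i. i < n \<Longrightarrow> z i < z' i"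
      using laguerre_tower_roots_increase by blast
    have "-1 < \<gamma>" using \<beta>\<gamma> by simp
    show ?thesis
      using laguerre_hermite_zero_eq[OF \<beta>\<gamma>(1) z j] laguerre_hermite_zero_eq[OF \<open>-1 < \<gamma>\<close> z' j]
        less[of "n - j"] less[of "j - n - 1"] j
      by (auto simp: symmetric_square_roots_def)
  qed
  thus ?thesis
    using zeros by (auto simp: monotone_on_def)
qed

end
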